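(* Let $p$ be a prime number. For any real $\tilde{\mu}>2$ and any $\epsilon>0$, there exists $\xi \in \mathbb{Z}_{p}$ and a sequence $((x_{j,0}, x_{j,1}))_{j \ge 1}$ of pairs of coprime integers not divisible by $p$, whose absolute values tend to infinity, with the following properties: (1) $|x_{j,0}|\asymp |x_{j,1}|$ and $|x_{j,1}\xi - x_{j,0}|_{p} \asymp |x_{j,0}|^{- \tilde{\mu} }\asymp |x_{j,1}|^{- \tilde{\mu} }$ for all $j\geq 1$; (2) $\displaystyle\lim_{j\to\infty} \frac{\log |x_{j+1,0}|}{\log |x_{j,0}|}= \infty$; (3) for every integer pair $(z_{0},z_{1})$ linearly independent of every pair $(x_{j,0},x_{j,1})$, $j \ge 1$, we have $$|z_{1}\xi - z_{0}|_{p} \gg \max\{ |z_{0}|, |z_{1}|\}^{-2-\epsilon}.$$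
   Context: $\mathbb{Z}_p$ is the ring of $p$-adic integers and $|\cdot|_p$ the $p$-adic absolute value with $|p|_p=p^{-1}$. $A\ll B$ means $A\le cB$ for a positive constant $c$ independent of $j$ and of $(z_0,z_1)$; $A\asymp B$ means $A\ll B$ and $B\ll A$. *)

theory Defs
  imports Complex_Main "HOL-Algebra.Ring" "HOL-Computational_Algebra.Primes"
begin

text \<open>
  The ring of \<open>p\<close>-adic integers as the inverse limit of the rings \<open>\<int>/p\<^sup>n\<int>\<close>: an element is the
  sequence of its residues modulo \<open>p\<^sup>n\<close>, each represented in \<open>{0..<p\<^sup>n}\<close>.  All constants are
  reduced modulo \<open>p\<^sup>n\<close>, including the unit, since \<open>n = 0\<close> gives the zero ring.
\<close>

definition padic_int :: "nat \<Rightarrow> (nat \<Rightarrow> int) ring" where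
  "padic_int p =
    \<lparr>carrier = {x. \<forall>n. x n \<in> {0..<int p ^ n} \<and> x (Suc n) mod int p ^ n = x n},
     monoid.mult = (\<lambda>x y n. (x n * y n) mod int p ^ n),
     one = (\<lambda>n. 1 mod int p ^ n),
     zero = (\<lambda>n. 0),
     add = (\<lambda>x y n. (x n + y n) mod int p ^ n)\<rparr>"

definition padic_of_int :: "nat \<Rightarrow> int \<Rightarrow> (nat \<Rightarrow> int)" where
  "padic_of_int p k = (\<lambda>n. k mod int p ^ n)"

text \<open>
  For \<open>x \<noteq> 0\<close> the valuation is the largest \<open>n\<close> with \<open>x \<equiv> 0\<close> modulo \<open>p\<^sup>n\<close>, i.e. the least \<open>n\<close>
  such that the residue modulo \<open>p\<^sup>n\<^sup>+\<^sup>1\<close> is nonzero.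
\<close>

definition padic_val :: "(nat \<Rightarrow> int) \<Rightarrow> nat" where
  "padic_val x = (LEAST n. x (Suc n) \<noteq> 0)"

definition padic_abs :: "nat \<Rightarrow> (nat \<Rightarrow> int) \<Rightarrow> real" where
  "padic_abs p x = (if x = \<zero>\<^bsub>padic_int p\<^esub> then 0 else (1 / real p) ^ padic_val x)"

text \<open>
  \<open>ll_on S A B\<close> is \<open>A \<lless> B\<close> with a constant that is uniform over the parameters ranging in \<open>S\<close>.
\<close>

definition ll_on :: "'a set \<Rightarrow> ('a \<Rightarrow> real) \<Rightarrow> ('a \<Rightarrow> real) \<Rightarrow> bool" where
  "ll_on S A B \<longleftrightarrow> (\<exists>c>0. \<forall>s\<in>S. A s \<le> c * B s)"

definition same_order_on :: "'a set \<Rightarrow> ('a \<Rightarrow> real) \<Rightarrow> ('a \<Rightarrow> real) \<Rightarrow> bool" where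
  "same_order_on S A B \<longleftrightarrow> ll_on S A B \<and> ll_on S B A"

text \<open>
  Linear independence of two integer vectors as a family; a set-based notion would wrongly count
  two equal nonzero vectors as independent.  Integer and rational coefficients give the same notion.
\<close>

definition lin_indep_pair :: "int \<times> int \<Rightarrow> int \<times> int \<Rightarrow> bool" where
  "lin_indep_pair u v \<longleftrightarrow>
    (\<forall>a b. a * fst u + b * fst v = 0 \<and> a * snd u + b * snd v = 0 \<longrightarrow> a = 0 \<and> b = 0)"

lemma padic_int_simps:
  "\<zero>\<^bsub>padic_int p\<^esub> = (\<lambda>n. 0)"
  "\<one>\<^bsub>padic_int p\<^esub> = (\<lambda>n. 1 mod int p ^ n)"
  "x \<oplus>\<^bsub>padic_int p\<^esub> y = (\<lambda>n. (x n + y n) mod int p ^ n)"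
  "x \<otimes>\<^bsub>padic_int p\<^esub> y = (\<lambda>n. (x n * y n) mod int p ^ n)"
  by (simp_all add: padic_int_def)

lemma padic_int_memI:
  assumes "p > 0" "\<And>n. x n = f n mod int p ^ n" "\<And>n. f (Suc n) mod int p ^ n = f n mod int p ^ n"
  shows "x \<in> carrier (padic_int p)"
proof -
  have "x n \<in> {0..<int p ^ n} \<and> x (Suc n) mod int p ^ n = x n" for n
  proof -
    have "(f (Suc n) mod int p ^ Suc n) mod int p ^ n = f (Suc n) mod int p ^ n"
      by (rule mod_mod_cancel) simp
    with assms show ?thesis by simp
  qed
  then show ?thesis by (simp add: padic_int_def)
qed

lemma padic_int_memD:
  assumes "x \<in> carrier (padic_int p)"
  shows "x n mod int p ^ n = x n" "x (Suc n) mod int p ^ n = x n"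
  using assms by (auto simp: padic_int_def)

lemma padic_add_closed:
  assumes "p > 0" "x \<in> carrier (padic_int p)" "y \<in> carrier (padic_int p)"
  shows "x \<oplus>\<^bsub>padic_int p\<^esub> y \<in> carrier (padic_int p)"
  by (rule padic_int_memI[where f = "\<lambda>n. x n + y n"])
     (use assms padic_int_memD in \<open>auto simp: padic_int_simps intro: mod_add_cong\<close>)

lemma padic_mult_closed:
  assumes "p > 0" "x \<in> carrier (padic_int p)" "y \<in> carrier (padic_int p)"
  shows "x \<otimes>\<^bsub>padic_int p\<^esub> y \<in> carrier (padic_int p)"
  by (rule padic_int_memI[where f = "\<lambda>n. x n * y n"])
     (use assms padic_int_memD in \<open>auto simp: padic_int_simps intro: mod_mult_cong\<close>)

lemma padic_neg_closed:
  assumes "p > 0" "x \<in> carrier (padic_int p)"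
  shows "(\<lambda>n. (- x n) mod int p ^ n) \<in> carrier (padic_int p)"
  by (rule padic_int_memI[where f = "\<lambda>n. - x n"])
     (use assms padic_int_memD in \<open>auto intro: mod_minus_cong\<close>)

lemma padic_of_int_closed: "p > 0 \<Longrightarrow> padic_of_int p k \<in> carrier (padic_int p)"
  by (rule padic_int_memI[where f = "\<lambda>_. k"]) (auto simp: padic_of_int_def)

lemma padic_of_int_simps:
  "padic_of_int p 0 = \<zero>\<^bsub>padic_int p\<^esub>"
  "padic_of_int p 1 = \<one>\<^bsub>padic_int p\<^esub>"
  "padic_of_int p (k + l) = padic_of_int p k \<oplus>\<^bsub>padic_int p\<^esub> padic_of_int p l"
  "padic_of_int p (k * l) = padic_of_int p k \<otimes>\<^bsub>padic_int p\<^esub> padic_of_int p l"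
  by (simp_all add: padic_of_int_def padic_int_simps mod_simps)

theorem padic_int_cring:
  assumes "p > 0"
  shows "cring (padic_int p)"
proof (rule cringI)
  show "abelian_group (padic_int p)"
  proof (rule abelian_groupI)
    fix x assume x: "x \<in> carrier (padic_int p)"
    show "\<exists>y\<in>carrier (padic_int p). y \<oplus>\<^bsub>padic_int p\<^esub> x = \<zero>\<^bsub>padic_int p\<^esub>"
      by (rule bexI[OF _ padic_neg_closed[OF assms x]]) (simp add: padic_int_simps mod_simps)
  qed (use assms padic_of_int_closed[OF assms, of 0] in
        \<open>auto simp: padic_add_closed padic_of_int_simps\<close>,
       auto simp: padic_int_simps padic_int_memD mod_simps algebra_simps)
next
  show "comm_monoid (padic_int p)"
  proof (rule comm_monoidI)
    show "\<one>\<^bsub>padic_int p\<^esub> \<in> carrier (padic_int p)"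
      using padic_of_int_closed[OF assms, of 1] by (simp add: padic_of_int_simps)
  qed (use assms in \<open>auto simp: padic_mult_closed\<close>,
       auto simp: padic_int_simps padic_int_memD mod_simps algebra_simps)
qed (auto simp: padic_int_simps mod_simps algebra_simps)

lemma padic_minus_nth:
  assumes "p > 0" "x \<in> carrier (padic_int p)" "y \<in> carrier (padic_int p)"
  shows "(x \<ominus>\<^bsub>padic_int p\<^esub> y) n = (x n - y n) mod int p ^ n"
proof -
  interpret cring "padic_int p" by (rule padic_int_cring[OF assms(1)])
  have "\<ominus>\<^bsub>padic_int p\<^esub> y = (\<lambda>n. (- y n) mod int p ^ n)"
    by (rule minus_equality)
       (use assms padic_neg_closed in \<open>auto simp: padic_int_simps mod_simps\<close>)
  then show ?thesis
    by (simp add: a_minus_def padic_int_simps mod_simps)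
qed

lemma padic_abs_of_int:
  assumes "prime p" "k \<noteq> 0"
  shows "padic_abs p (padic_of_int p k) = (1 / real p) ^ multiplicity (int p) k"
proof -
  have nu: "\<not> is_unit (int p)" using assms(1) by (auto simp: prime_nat_iff)
  have eq: "padic_of_int p k n = 0 \<longleftrightarrow> n \<le> multiplicity (int p) k" for n
    using power_dvd_iff_le_multiplicity[of k "int p" n] nu assms(2)
    by (simp add: padic_of_int_def mod_eq_0_iff_dvd)
  have "padic_of_int p k \<noteq> \<zero>\<^bsub>padic_int p\<^esub>"
    using eq[of "Suc (multiplicity (int p) k)"] by (auto simp: padic_int_simps)
  moreover have "padic_val (padic_of_int p k) = multiplicity (int p) k"
    unfolding padic_val_def by (rule Least_equality) (auto simp: eq)
  ultimately show ?thesis by (simp add: padic_abs_def)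
qed

end

(* Let L_n be the lattice of integer pairs (a, b) with b xi = a mod p^n.  It has index p^n, so
   independent elements satisfy p^n <= 2 |u| |v|.  The digits of xi are chosen one at a time.
   Normally the next digit expels a shortest vector of L_n from L_(n+1); this rebalances the lattice
   until its shortest vector has length about p^(n/2), and keeps it balanced from then on.  Once
   balanced, Thue's lemma yields a vector (x0, x1) of L_n close to the diagonal and of length about
   p^(n/2); the following digits are chosen so as to keep it in L_n as long as
   p^n <= |x0|^mu, after which one returns to the normal mode.  During such an
   excursion x = (x0, x1) is, up to a constant, a shortest vector, so p^n <= 2 |x| |z| <= C |z|^2
   for every z in L_n that is not parallel to x; in the normal mode the same bound propagates
   by induction on n, because an element of L_(n+1) parallel to the expelled vector is p times an
   element of L_n. *)

theory Submission
  imports Defs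
begin

section \<open>Lattices of approximations\<close>

text \<open>The lattice L_n is taken for an integer \<open>r\<close>, of which only the residue
  modulo \<open>q ^ n\<close> matters, so that the later digits remain free.\<close>

definition approx :: "int \<Rightarrow> nat \<Rightarrow> int \<Rightarrow> int \<Rightarrow> int \<Rightarrow> bool" where
  "approx q n r a b \<longleftrightarrow> q ^ n dvd b * r - a"

definition ht :: "int \<Rightarrow> int \<Rightarrow> int" where
  "ht a b = max \<bar>a\<bar> \<bar>b\<bar>"

definition shortest :: "int \<Rightarrow> nat \<Rightarrow> int \<Rightarrow> int \<Rightarrow> int \<Rightarrow> bool" where
  "shortest q n r a b \<longleftrightarrow> approx q n r a b \<and> ht a b > 0 \<and>
     (\<forall>c d. approx q n r c d \<longrightarrow> ht c d > 0 \<longrightarrow> ht a b \<le> ht c d)"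

text \<open>The digit of \<open>r\<close> at \<open>q ^ n\<close> expels a shortest vector of L_n.
  This depends on \<open>r\<close> modulo \<open>q ^ Suc n\<close>, one power more than
  \<open>shortest\<close> does.\<close>

definition avoiding :: "int \<Rightarrow> nat \<Rightarrow> int \<Rightarrow> bool" where
  "avoiding q n r \<longleftrightarrow> (\<exists>a b. shortest q n r a b \<and> \<not> approx q (Suc n) r a b)"

lemma ht_nonneg: "ht a b \<ge> 0"
  by (simp add: ht_def)

lemma ht_pos_iff: "ht a b > 0 \<longleftrightarrow> a \<noteq> 0 \<or> b \<noteq> 0"
  by (auto simp: ht_def)

lemma ht_mult: "ht (k * a) (k * b) = \<bar>k\<bar> * ht a b"
  by (simp add: ht_def abs_mult max_mult_distrib_left)

lemma abs_det_le: "\<bar>a * d - b * c\<bar> \<le> 2 * (ht a b * ht c d)"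
proof -
  have "\<bar>a * d\<bar> \<le> ht a b * ht c d" "\<bar>b * c\<bar> \<le> ht a b * ht c d"
    unfolding abs_mult by (auto simp: ht_def intro!: mult_mono)
  then show ?thesis by linarith
qed

lemma approx_mono: "approx q n r a b \<Longrightarrow> m \<le> n \<Longrightarrow> approx q m r a b"
  unfolding approx_def by (meson dvd_trans le_imp_power_dvd)

lemma approx_mult: "approx q n r a b \<Longrightarrow> approx q n r (k * a) (k * b)"
  unfolding approx_def using dvd_mult[of "q ^ n" "b * r - a" k] by (simp add: algebra_simps)

lemma approx_diff:
  "approx q n r a b \<Longrightarrow> approx q n r c d \<Longrightarrow> approx q n r (a - c) (b - d)"
proof -
  assume "approx q n r a b" "approx q n r c d"
  then have "q ^ n dvd (b * r - a) - (d * r - c)"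
    unfolding approx_def by (rule dvd_diff)
  then show ?thesis by (simp add: approx_def algebra_simps)
qed

lemma approx_cong:
  assumes "q ^ n dvd r - s"
  shows "approx q n r a b \<longleftrightarrow> approx q n s a b"
proof -
  have "q ^ n dvd b * (r - s)"
    using assms by simp
  from dvd_add_right_iff[OF this, of "b * s - a"] show ?thesis
    by (simp add: approx_def algebra_simps)
qed

lemma shortest_cong:
  assumes "q ^ n dvd r - s"
  shows "shortest q n r a b \<longleftrightarrow> shortest q n s a b"
  unfolding shortest_def approx_cong[OF assms] ..

lemma avoiding_cong:
  assumes "q ^ Suc n dvd r - s"
  shows "avoiding q n r \<longleftrightarrow> avoiding q n s"
proof -
  have "q ^ n dvd r - s"
    using assms by (meson dvd_trans le_imp_power_dvd lessI less_imp_le)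
  then show ?thesis
    unfolding avoiding_def using approx_cong[OF assms] shortest_cong by metis
qed

text \<open>Eliminating \<open>r\<close> from the two congruences shows that \<open>q ^ n\<close>
  divides the determinant, which is nonzero.\<close>

lemma approx_det_le:
  assumes "q > 0" "approx q n r a b" "approx q n r c d" "a * d \<noteq> b * c"
  shows "q ^ n \<le> 2 * (ht a b * ht c d)"
proof -
  have "q ^ n dvd b * (d * r - c) - d * (b * r - a)"
    using assms by (intro dvd_diff[OF dvd_mult dvd_mult]) (auto simp: approx_def)
  also have "b * (d * r - c) - d * (b * r - a) = a * d - b * c"
    by (simp add: algebra_simps)
  finally have "q ^ n \<le> \<bar>a * d - b * c\<bar>"
    using assms by (intro zdvd_imp_le) (auto simp: dvd_abs_iff)
  with abs_det_le[of a d b c] show ?thesis by linarith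
qed

section \<open>Shortest vectors and their expulsion\<close>

lemma shortest_exists:
  obtains a b where "shortest q n r a b"
proof -
  define P where "P = (\<lambda>(a, b). approx q n r a b \<and> ht a b > 0)"
  have "P (r, 1)" by (auto simp: P_def approx_def ht_def)
  then obtain z where z: "P z" "\<And>y. P y \<Longrightarrow> nat (case_prod ht z) \<le> nat (case_prod ht y)"
    using ex_has_least_nat[of P _ "\<lambda>z. nat (case_prod ht z)"] by blast
  obtain a b where ab: "z = (a, b)" by fastforce
  have "ht a b \<le> ht c d" if "approx q n r c d" "ht c d > 0" for c d
    using z(2)[of "(c, d)"] that by (simp add: P_def ab)
  with z(1) show ?thesis
    by (intro that[of a b]) (auto simp: shortest_def P_def ab)
qed

text \<open>Rounded division leaves a remainder shorter than the shortest vector, hence zero.\<close>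

lemma parallel_shortest_multiple:
  assumes u: "shortest q n r a b" and v: "approx q n r c d" and par: "a * d = b * c"
  obtains k where "c = k * a" "d = k * b"
proof -
  have reduce: "c - k * a = 0 \<and> d - k * b = 0" if "ht (c - k * a) (d - k * b) < ht a b" for k
  proof -
    have "approx q n r (c - k * a) (d - k * b)"
      using u v by (intro approx_diff approx_mult) (auto simp: shortest_def)
    then have "\<not> ht (c - k * a) (d - k * b) > 0"
      using u that unfolding shortest_def by fastforce
    then show ?thesis by (auto simp: ht_pos_iff)
  qed
  have small: "\<bar>y\<bar> < \<bar>s\<bar>" if "s * y = t * x" "\<bar>t\<bar> \<le> \<bar>s\<bar>" "\<bar>x\<bar> < \<bar>s\<bar>" for s t x y :: int
  proof -
    have "\<bar>s\<bar> * \<bar>y\<bar> = \<bar>t\<bar> * \<bar>x\<bar>" using that(1) by (metis abs_mult)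
    also have "\<dots> \<le> \<bar>s\<bar> * \<bar>x\<bar>" using that by (intro mult_right_mono) auto
    finally have "\<bar>y\<bar> \<le> \<bar>x\<bar>" using that by (simp add: mult_le_cancel_left)
    with that show ?thesis by linarith
  qed
  have nz: "a \<noteq> 0 \<or> b \<noteq> 0" using u by (simp add: shortest_def ht_pos_iff)
  have "\<exists>k. ht (c - k * a) (d - k * b) < ht a b"
  proof (cases "\<bar>b\<bar> \<le> \<bar>a\<bar>")
    case True
    define k where "k = c div a"
    have "c - k * a = c mod a" by (simp add: k_def minus_div_mult_eq_mod)
    then have c: "\<bar>c - k * a\<bar> < \<bar>a\<bar>" using nz True abs_mod_less[of a c] by force
    have "a * (d - k * b) = b * (c - k * a)" using par by (simp add: algebra_simps)
    from small[OF this True c] c have "ht (c - k * a) (d - k * b) < ht a b"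
      by (auto simp: ht_def)
    then show ?thesis ..
  next
    case False
    define k where "k = d div b"
    have "d - k * b = d mod b" by (simp add: k_def minus_div_mult_eq_mod)
    then have d: "\<bar>d - k * b\<bar> < \<bar>b\<bar>" using False abs_mod_less[of b d] by force
    have "b * (c - k * a) = a * (d - k * b)" using par by (simp add: algebra_simps)
    from small[OF this _ d] d False have "ht (c - k * a) (d - k * b) < ht a b"
      by (auto simp: ht_def)
    then show ?thesis ..
  qed
  then show ?thesis using reduce that by force
qed

text \<open>Let u be the expelled shortest vector. A nonzero vector is at least as long as u, so if
  it is not parallel to u the determinant bound gives the first alternative. A parallel one is
  \<open>k\<close> times u, and \<open>q\<close> divides \<open>k\<close> because u itself is not in
  L_(n+1).\<close>

lemma avoiding_dichotomy:
  assumes q: "prime q" and av: "avoiding q n r" and v: "approx q (Suc n) r c d"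
  shows "q ^ n \<le> 2 * ht c d ^ 2 \<or> (\<exists>c' d'. c = q * c' \<and> d = q * d' \<and> approx q n r c' d')"
proof (cases "ht c d > 0")
  case pos: True
  obtain a b where u: "shortest q n r a b" and nu: "\<not> approx q (Suc n) r a b"
    using av by (auto simp: avoiding_def)
  have vn: "approx q n r c d" using v by (rule approx_mono) simp
  have q0: "q > 0" using q by (simp add: prime_gt_0_int)
  show ?thesis
  proof (cases "a * d = b * c")
    case False
    have "q ^ n \<le> 2 * (ht a b * ht c d)"
      using approx_det_le[OF q0 _ vn False] u by (simp add: shortest_def)
    also have "ht a b * ht c d \<le> ht c d * ht c d"
      using u vn pos by (intro mult_right_mono) (auto simp: shortest_def)
    finally show ?thesis by (simp add: power2_eq_square)
  next
    case True
    obtain k where k: "c = k * a" "d = k * b"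
      using parallel_shortest_multiple[OF u vn True] .
    have "q dvd k"
    proof (rule ccontr)
      assume "\<not> q dvd k"
      then have "coprime (q ^ Suc n) k" using q by (simp add: prime_imp_coprime)
      moreover have "q ^ Suc n dvd k * (b * r - a)"
        using v unfolding approx_def k by (simp add: algebra_simps)
      ultimately have "q ^ Suc n dvd b * r - a" using coprime_dvd_mult_right_iff by blast
      with nu show False by (simp add: approx_def)
    qed
    then obtain l where "k = q * l" ..
    then show ?thesis
      using k u by (auto simp: shortest_def mult.assoc intro!: approx_mult)
  qed
next
  case False
  then have "c = 0" "d = 0" by (auto simp: ht_pos_iff)
  then show ?thesis by (intro disjI2 exI[of _ 0]) (simp add: approx_def)
qed

text \<open>If no digit expelled the shortest vector \<open>(a, b)\<close>, the digits 0 and 1 would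
  already force \<open>q\<close> to divide \<open>b\<close> and then \<open>a\<close>; dividing by
  \<open>q\<close> would leave a shorter nonzero vector of L_n.\<close>

lemma avoiding_step:
  assumes q: "prime q"
  obtains s where "q ^ n dvd s - r" "avoiding q n s"
proof -
  obtain a b where u: "shortest q n r a b" using shortest_exists .
  have q0: "q > 0" "q > 1" using q by (auto simp: prime_gt_0_int prime_gt_1_int)
  have "\<exists>e. \<not> approx q (Suc n) (r + e * q ^ n) a b"
  proof (rule ccontr)
    assume "\<not> ?thesis"
    then have all: "approx q (Suc n) (r + e * q ^ n) a b" for e by blast
    have "q ^ Suc n dvd (b * (r + 1 * q ^ n) - a) - (b * (r + 0 * q ^ n) - a)"
      using all[of 0] all[of 1] unfolding approx_def by (rule dvd_diff[rotated])
    then have "q ^ Suc n dvd q ^ n * b" by (simp add: algebra_simps)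
    then have "q dvd b" using q0 by simp
    then obtain b' where b': "b = q * b'" ..
    have dvd: "q ^ Suc n dvd b * r - a" using all[of 0] by (simp add: approx_def)
    then have "q dvd b * r - a" using dvd_mult_left[of q "q ^ n"] by simp
    then have "q dvd b * r - (b * r - a)" by (rule dvd_diff[OF dvd_mult2[OF \<open>q dvd b\<close>]])
    then have "q dvd a" by simp
    then obtain a' where a': "a = q * a'" ..
    have "q * q ^ n dvd q * (b' * r - a')" using dvd a' b' by (simp add: algebra_simps)
    then have "approx q n r a' b'" using q0 by (simp add: approx_def)
    moreover have "ht a b = q * ht a' b'" using q0 by (simp add: a' b' ht_mult)
    moreover have pos: "ht a b > 0" using u by (simp add: shortest_def)
    ultimately have "ht a' b' > 0" "ht a b \<le> ht a' b'"
      using u q0 by (auto simp: shortest_def zero_less_mult_iff)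
    moreover have "1 * ht a' b' < q * ht a' b'"
      using q0 \<open>ht a' b' > 0\<close> by (intro mult_strict_right_mono) auto
    ultimately show False using \<open>ht a b = q * ht a' b'\<close> by linarith
  qed
  then obtain e where e: "\<not> approx q (Suc n) (r + e * q ^ n) a b" ..
  have "shortest q n (r + e * q ^ n) a b"
    using u shortest_cong[of q n "r + e * q ^ n" r] by simp
  with e show ?thesis
    by (intro that[of "r + e * q ^ n"]) (auto simp: avoiding_def)
qed

text \<open>The digit chosen at level \<open>n + k\<close> leaves the earlier levels intact, since
  \<open>avoiding q i\<close> reads only the residue modulo \<open>q ^ Suc i\<close>.\<close>

lemma avoiding_extend:
  assumes q: "prime q"
  obtains s where "q ^ n dvd s - r" "\<forall>i\<in>{n..<n + k}. avoiding q i s"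
proof -
  have "\<exists>s. q ^ n dvd s - r \<and> (\<forall>i\<in>{n..<n + k}. avoiding q i s)"
  proof (induction k)
    case 0
    show ?case by (rule exI[of _ r]) auto
  next
    case (Suc k)
    then obtain s where s: "q ^ n dvd s - r" "\<forall>i\<in>{n..<n + k}. avoiding q i s" by blast
    obtain t where t: "q ^ (n + k) dvd t - s" "avoiding q (n + k) t"
      using avoiding_step[OF q] .
    have "q ^ n dvd (t - s) + (s - r)"
      using s(1) t(1) by (intro dvd_add) (auto simp: power_add dest: dvd_mult_left)
    then have "q ^ n dvd t - r" by simp
    moreover have "avoiding q i t" if "i \<in> {n..<n + Suc k}" for i
    proof (cases "i = n + k")
      case False
      with that have i: "i \<in> {n..<n + k}" by auto
      then have "q ^ Suc i dvd t - s"
        by (intro dvd_trans[OF le_imp_power_dvd t(1)]) auto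
      with avoiding_cong[OF this] s(2) i show ?thesis by blast
    qed (use t in auto)
    ultimately show ?case by blast
  qed
  with that show ?thesis by blast
qed

text \<open>Going down from level \<open>n + k\<close>, a vector either meets the bound of the
  dichotomy or is \<open>q\<close> times a vector one level lower. Undoing a division multiplies the
  squared height by \<open>q ^ 2\<close> but the index only by \<open>q\<close>, so the first
  alternative survives; if all \<open>k\<close> steps divide, the height is at least
  \<open>q ^ k\<close>.\<close>

lemma avoiding_lower_bound:
  assumes q: "prime q" and av: "\<forall>i\<in>{n..<n + k}. avoiding q i r"
    and v: "approx q (n + k) r c d" "ht c d > 0"
  shows "q ^ (n + k) \<le> 2 * q * ht c d ^ 2 \<or> q ^ k \<le> ht c d"
  using av v
proof (induction k arbitrary: c d)
  case (Suc k)
  have q1: "q > 1" using q by (rule prime_gt_1_int)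
  have "avoiding q (n + k) r" using Suc.prems by auto
  from avoiding_dichotomy[OF q this, of c d] Suc.prems(2)
  consider "q ^ (n + k) \<le> 2 * ht c d ^ 2"
    | c' d' where "c = q * c'" "d = q * d'" "approx q (n + k) r c' d'" by auto
  then show ?case
  proof cases
    case 1
    then have "q * q ^ (n + k) \<le> q * (2 * ht c d ^ 2)" using q1 by (intro mult_left_mono) auto
    then show ?thesis by (simp add: mult_ac)
  next
    case 2
    have h: "ht c d = q * ht c' d'" using q1 2 by (simp add: ht_mult)
    then have "ht c' d' > 0" using Suc.prems(3) q1 by (simp add: zero_less_mult_iff)
    from Suc.IH[OF _ 2(3) this] Suc.prems(1)
    consider "q ^ (n + k) \<le> 2 * q * ht c' d' ^ 2" | "q ^ k \<le> ht c' d'" by auto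
    then show ?thesis
    proof cases
      case 1
      then have "q ^ 2 * q ^ (n + k) \<le> q ^ 2 * (2 * q * ht c' d' ^ 2)"
        using q1 by (intro mult_left_mono) auto
      moreover have "q * q ^ (n + k) \<le> q ^ 2 * q ^ (n + k)"
        using q1 by (intro mult_right_mono) (auto simp: power2_eq_square)
      ultimately show ?thesis by (simp add: h power_mult_distrib mult_ac)
    next
      case 2
      then show ?thesis using q1 by (simp add: h)
    qed
  qed
qed simp

text \<open>With at least as many expelling steps as there were levels before them, a height of
  \<open>q ^ (m - n)\<close> already has a square of \<open>q ^ m\<close> or more.\<close>

lemma avoiding_balanced:
  assumes q: "prime q" and av: "\<forall>i\<in>{n..<m}. avoiding q i r" and m: "2 * n \<le> m"
    and v: "approx q m r c d" "ht c d > 0"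
  shows "q ^ m \<le> 2 * q * ht c d ^ 2"
proof -
  have q1: "q > 1" using q by (rule prime_gt_1_int)
  have nm: "n + (m - n) = m" using m by simp
  have "q ^ m \<le> 2 * q * ht c d ^ 2" if "q ^ (m - n) \<le> ht c d"
  proof -
    have "q ^ m \<le> q ^ (2 * (m - n))" using q1 m by (intro power_increasing) auto
    also have "\<dots> = (q ^ (m - n)) ^ 2" by (simp add: mult.commute flip: power_mult)
    also have "\<dots> \<le> ht c d ^ 2" using that q1 by (intro power_mono) auto
    also have "\<dots> \<le> 2 * q * ht c d ^ 2" using q1 by (simp add: mult_le_cancel_right1)
    finally show ?thesis .
  qed
  with avoiding_lower_bound[OF q, of n "m - n" r c d] av v nm show ?thesis by auto
qed

text \<open>Pigeonhole: the box holds more pairs \<open>(t, w)\<close> than there are residues of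
  \<open>t * a - w\<close> modulo \<open>M\<close>, and the difference of two colliding pairs is the
  required pair.\<close>

lemma thue_lemma:
  fixes a M A B :: int
  assumes M: "M > 0" and AB: "A \<ge> 0" "B \<ge> 0" "(A + 1) * (B + 1) > M"
  obtains t w where "M dvd t * a - w" "\<bar>w\<bar> \<le> A" "\<bar>t\<bar> \<le> B" "t \<noteq> 0 \<or> w \<noteq> 0"
proof -
  define f where "f = (\<lambda>(t, w). (t * a - w) mod M)"
  have "f ` ({0..B} \<times> {0..A}) \<subseteq> {0..<M}" using M by (auto simp: f_def)
  then have "card (f ` ({0..B} \<times> {0..A})) \<le> card {0..<M}" by (intro card_mono) auto
  also have "\<dots> = nat M" by simp
  also have "\<dots> < nat ((A + 1) * (B + 1))" using AB M by simp
  also have "\<dots> = card ({0..B} \<times> {0..A})"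
    using AB by (simp add: nat_mult_distrib mult.commute)
  finally have "\<not> inj_on f ({0..B} \<times> {0..A})"
    by (rule pigeonhole)
  then obtain t w t' w' where *: "t \<in> {0..B}" "t' \<in> {0..B}" "w \<in> {0..A}" "w' \<in> {0..A}"
    "f (t, w) = f (t', w')" "(t, w) \<noteq> (t', w')"
    unfolding inj_on_def by fast
  have "M dvd (t * a - w) - (t' * a - w')"
    using *(5) by (simp add: f_def mod_eq_dvd_iff)
  then have "M dvd (t - t') * a - (w - w')" by (simp add: algebra_simps)
  moreover have "\<bar>w - w'\<bar> \<le> A" "\<bar>t - t'\<bar> \<le> B" "t - t' \<noteq> 0 \<or> w - w' \<noteq> 0"
    using * by auto
  ultimately show ?thesis by (rule that)
qed

section \<open>Creating one approximation\<close>

text \<open>The factor \<open>q ^ 4\<close> is what the construction affords: balance loses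
  \<open>2 * q\<close>, the near-diagonal vector loses \<open>q ^ 6\<close> in the squared height,
  and \<open>2 * q ^ 7 \<le> (q ^ 4) ^ 2\<close>.\<close>

definition dominating :: "int \<Rightarrow> nat \<Rightarrow> int \<Rightarrow> int \<Rightarrow> int \<Rightarrow> bool" where
  "dominating q n r a b \<longleftrightarrow> approx q n r a b \<and>
     (\<forall>c d. approx q n r c d \<longrightarrow> ht c d > 0 \<longrightarrow> ht a b \<le> q ^ 4 * ht c d)"

lemma dominating_cong:
  assumes "q ^ n dvd r - s"
  shows "dominating q n r a b \<longleftrightarrow> dominating q n s a b"
  unfolding dominating_def approx_cong[OF assms] ..

text \<open>As \<open>b\<close> is invertible modulo powers of \<open>q\<close>, one can solve
  \<open>b * s = a + q ^ N\<close> modulo \<open>q ^ Suc N\<close>. Modulo \<open>q ^ m\<close> both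
  \<open>r\<close> and \<open>s\<close> solve \<open>b * x = a\<close>, so they agree there.\<close>

lemma approx_prescribed_order:
  assumes q: "prime q" and b: "\<not> q dvd b" and ab: "approx q m r a b" and m: "m \<le> N"
  obtains s where "q ^ m dvd s - r" "approx q N s a b" "\<not> approx q (Suc N) s a b"
proof -
  have q1: "q > 1" using q by (rule prime_gt_1_int)
  have cop: "coprime (q ^ k) b" for k using q b by (simp add: prime_imp_coprime)
  obtain u v where uv: "u * b + v * q ^ Suc N = 1"
    using bezout_int[of b "q ^ Suc N"] cop[of "Suc N"] by (metis coprime_commute coprime_iff_gcd_eq_1)
  define s where "s = u * (a + q ^ N)"
  have "b * s - a = (u * b) * (a + q ^ N) - a" by (simp add: s_def)
  also have "u * b = 1 - v * q ^ Suc N" using uv by simp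
  finally have eq: "b * s - a = q ^ N - q ^ Suc N * (v * (a + q ^ N))"
    by (simp add: algebra_simps)
  have sN: "approx q N s a b"
    unfolding approx_def eq by (intro dvd_diff) (auto simp: power_Suc2)
  moreover have "\<not> approx q (Suc N) s a b"
  proof
    assume "approx q (Suc N) s a b"
    then have "q ^ Suc N dvd q ^ N - q ^ Suc N * (v * (a + q ^ N))"
      by (simp only: approx_def eq)
    from dvd_add[OF this dvd_triv_left[of "q ^ Suc N" "v * (a + q ^ N)"]]
    have "q ^ Suc N dvd q ^ N" by simp
    then have "q dvd 1" using q1 by (simp add: power_Suc2)
    with q1 show False by simp
  qed
  moreover have "q ^ m dvd b * (s - r)"
  proof -
    have "q ^ m dvd (b * s - a) - (b * r - a)"
      using approx_mono[OF sN m] ab unfolding approx_def by (rule dvd_diff)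
    then show ?thesis by (simp add: algebra_simps)
  qed
  then have "q ^ m dvd s - r" using cop[of m] coprime_dvd_mult_right_iff by blast
  ultimately show ?thesis using that by blast
qed

text \<open>Modulo \<open>q\<close> the congruence reads \<open>a = b * r\<close> with
  \<open>r\<close> a unit, so \<open>q\<close> divides both entries or neither, and coprimality
  excludes the former.\<close>

lemma coprime_approx_not_dvd:
  assumes q: "prime q" and r: "\<not> q dvd r" and n: "n \<ge> 1"
    and ab: "approx q n r a b" "coprime a b"
  shows "\<not> q dvd a" "\<not> q dvd b"
proof -
  have "approx q 1 r a b" using ab(1) n by (rule approx_mono)
  then have *: "q dvd b * r - a" by (simp add: approx_def)
  have "q dvd a \<longleftrightarrow> q dvd b"
  proof
    assume "q dvd a"
    with * have "q dvd (b * r - a) + a" by (rule dvd_add)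
    then have "q dvd b * r" by simp
    with q r show "q dvd b" by (simp add: prime_dvd_mult_iff)
  next
    assume "q dvd b"
    from dvd_diff[OF dvd_mult2[OF this, of r] *] show "q dvd a" by simp
  qed
  moreover have "\<not> (q dvd a \<and> q dvd b)"
    using ab(2) q by (meson coprime_common_divisor not_prime_unit)
  ultimately show "\<not> q dvd a" "\<not> q dvd b" by auto
qed

text \<open>Thue's lemma applied to \<open>r - 1\<close> gives \<open>(t + w, t)\<close> with \<open>w\<close> too small to account for the
  length that balance forces on the vector.  Dividing it by its gcd, whose \<open>q\<close>-part is \<open>q\<^sup>k\<close>,
  only lowers the level from \<open>2 * s\<close> to \<open>2 * s - k\<close>.\<close>

lemma coprime_approx_near_diagonal:
  assumes q: "prime q" and r: "\<not> q dvd r" and n: "n \<ge> 1" and s: "s \<ge> 2 * n + 3"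
    and av: "\<forall>i\<in>{n..<2 * s}. avoiding q i r"
  obtains m a b where "s \<le> m + 3" "m \<le> 2 * s" "approx q m r a b" "coprime a b"
    "\<bar>a\<bar> \<le> 2 * \<bar>b\<bar>" "\<bar>b\<bar> \<le> 2 * \<bar>a\<bar>" "ht a b ^ 2 \<le> q ^ (m + 6)"
proof -
  have q2: "q \<ge> 2" using q by (rule prime_ge_2_int)
  \<comment> \<open>The box is lopsided: \<open>w\<close> ranges up to \<open>q ^ (s - 2)\<close>
    and \<open>t\<close> up to \<open>q ^ (s + 2)\<close>. The product is still
    \<open>q ^ (2 * s)\<close>, and \<open>A\<close> is small enough for balance to give
    \<open>2 * A \<le> ht X t\<close>.\<close>
  define A where "A = q ^ (s - 2)"
  have A0: "A > 0" using q2 by (simp add: A_def)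
  have pow: "q ^ (s + 2) = q ^ 4 * A" "q ^ (2 * s) = q ^ 4 * A ^ 2" "q ^ (s + 3) = q ^ 5 * A"
  proof -
    have s': "s + 2 = 4 + (s - 2)" "2 * s = 4 + (s - 2) * 2" "s + 3 = 5 + (s - 2)"
      using s by simp_all
    show "q ^ (s + 2) = q ^ 4 * A" "q ^ (2 * s) = q ^ 4 * A ^ 2" "q ^ (s + 3) = q ^ 5 * A"
      unfolding s' by (simp_all only: A_def power_add power_mult)
  qed
  obtain t w where tw: "q ^ (2 * s) dvd t * (r - 1) - w" "\<bar>w\<bar> \<le> A" "\<bar>t\<bar> \<le> q ^ (s + 2)"
    "t \<noteq> 0 \<or> w \<noteq> 0"
  proof (rule thue_lemma[of "q ^ (2 * s)" A "q ^ (s + 2)" "r - 1"])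
    have "q ^ (2 * s) = A * q ^ (s + 2)" unfolding pow power2_eq_square by simp
    also have "\<dots> < (A + 1) * (q ^ (s + 2) + 1)" using A0 q2 by (intro mult_strict_mono) auto
    finally show "(A + 1) * (q ^ (s + 2) + 1) > q ^ (2 * s)" .
  qed (use q2 A0 in auto)
  define X where "X = t + w"
  have X: "approx q (2 * s) r X t"
    using tw(1) by (simp add: approx_def X_def algebra_simps)
  have H0: "ht X t > 0" using tw(4) by (auto simp: ht_pos_iff X_def)
  have q3: "q ^ 3 \<ge> 8" using power_mono[OF q2, of 3] by simp
  have q4: "q ^ 4 \<ge> 1" "q ^ 4 * q = q ^ 5" using q2 by (auto simp flip: power_Suc2)
  have "2 * q * (4 * A ^ 2) = 8 * (q * A ^ 2)" by simp
  also have "\<dots> \<le> q ^ 3 * (q * A ^ 2)" using q3 q2 by (intro mult_right_mono) auto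
  also have "\<dots> = q ^ (2 * s)" unfolding pow by (simp add: power_numeral_reduce)
  also have "\<dots> \<le> 2 * q * ht X t ^ 2"
    using avoiding_balanced[OF q av _ X H0] s by simp
  finally have "(2 * A) ^ 2 \<le> ht X t ^ 2" using q2 by simp
  then have AH: "2 * A \<le> ht X t" using ht_nonneg by (rule power2_le_imp_le)
  have cone: "\<bar>X\<bar> \<le> 2 * \<bar>t\<bar>" "\<bar>t\<bar> \<le> 2 * \<bar>X\<bar>"
  proof -
    have "2 * A \<le> \<bar>X\<bar> \<or> 2 * A \<le> \<bar>t\<bar>" using AH by (simp add: ht_def le_max_iff_disj)
    moreover have "\<bar>X\<bar> \<le> \<bar>t\<bar> + \<bar>w\<bar>" "\<bar>t\<bar> \<le> \<bar>X\<bar> + \<bar>w\<bar>" unfolding X_def by linarith+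
    ultimately show "\<bar>X\<bar> \<le> 2 * \<bar>t\<bar>" "\<bar>t\<bar> \<le> 2 * \<bar>X\<bar>" using tw(2) by (smt (verit))+
  qed
  have "ht X t \<le> q ^ (s + 2) + A" using tw(2,3) A0 by (auto simp: ht_def X_def)
  also have "\<dots> \<le> q ^ (s + 2) * 2" unfolding pow using q4 A0 by simp
  also have "\<dots> \<le> q ^ (s + 2) * q" using q2 by (intro mult_left_mono) auto
  finally have HB: "ht X t \<le> q ^ (s + 3)" by (simp add: eval_nat_numeral mult_ac)

  define d where "d = gcd X t"
  have d0: "d > 0" using tw(4) by (auto simp: d_def X_def)
  define a b where "a = X div d" and "b = t div d"
  have ab: "X = d * a" "t = d * b" by (auto simp: a_def b_def d_def)
  have cop: "coprime a b" unfolding a_def b_def d_def using d0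
    by (intro div_gcd_coprime) (auto simp: d_def)
  have dH: "d * ht a b = ht X t" using d0 by (simp add: ab ht_mult)
  have h1: "ht a b \<ge> 1" using H0 d0 by (simp add: zero_less_mult_iff flip: dH)
  obtain k e where e: "d = q ^ k * e" "\<not> q dvd e"
  proof (rule multiplicity_decompose'[of d q])
    show "\<not> is_unit q" "d \<noteq> 0" using d0 q2 by auto
  qed
  have "q ^ k * e > 0" using d0 e(1) by simp
  then have e0: "e \<ge> 1" using q2 by (simp add: zero_less_mult_iff)
  have "q ^ k * 1 \<le> q ^ k * e" using e0 q2 by (intro mult_left_mono) auto
  then have "q ^ k \<le> d" using e(1) by simp
  then have kh: "q ^ k * ht a b \<le> q ^ (s + 3)"
    using mult_right_mono[of "q ^ k" d "ht a b"] h1 dH HB by simp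
  moreover have "q ^ k \<le> q ^ k * ht a b" using h1 q2 by (simp add: mult_le_cancel_left1)
  ultimately have "q ^ k \<le> q ^ (s + 3)" by linarith
  \<comment> \<open>Hence \<open>2 * s - k\<close> is a genuine difference and at least
    \<open>s - 3\<close>: removing the gcd costs at most about half of the levels.\<close>
  then have k: "k \<le> s + 3" using q2 by simp
  define m where "m = 2 * s - k"
  have mk: "2 * s = k + m" using k s by (simp add: m_def)
  have "q ^ k * q ^ m dvd q ^ k * (e * (b * r - a))"
    using X unfolding approx_def mk power_add ab e(1) by (simp add: algebra_simps)
  then have "q ^ m dvd e * (b * r - a)" using q2 by simp
  moreover have "coprime (q ^ m) e" using q e(2) by (simp add: prime_imp_coprime)
  ultimately have "approx q m r a b" unfolding approx_def using coprime_dvd_mult_right_iff by blast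
  moreover have "ht a b ^ 2 \<le> q ^ (m + 6)"
  proof -
    \<comment> \<open>Multiplied by \<open>q ^ k\<close>, the claim has the right-hand side
      \<open>q ^ (2 * s + 6)\<close>, the square of the bound in \<open>kh\<close>; squaring
      \<open>kh\<close> leaves a surplus factor \<open>q ^ k\<close> on the left, which is at least
      1.\<close>
    have "q ^ k * ht a b ^ 2 \<le> q ^ k * (q ^ k * ht a b ^ 2)"
      using mult_right_mono[of 1 "q ^ k" "q ^ k * ht a b ^ 2"] q2 by simp
    also have "\<dots> = (q ^ k * ht a b) ^ 2" by (simp add: power2_eq_square)
    also have "\<dots> \<le> (q ^ (s + 3)) ^ 2" using kh h1 q2 by (intro power_mono) auto
    also have "\<dots> = q ^ (2 * s + 6)" by (simp add: mult.commute flip: power_mult)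
    also have "\<dots> = q ^ k * q ^ (m + 6)" by (simp add: mk power_add)
    finally show ?thesis using q2 by simp
  qed
  moreover have "\<bar>a\<bar> \<le> 2 * \<bar>b\<bar>" "\<bar>b\<bar> \<le> 2 * \<bar>a\<bar>"
    using cone d0 by (auto simp: ab abs_mult mult.left_commute)
  moreover have "s \<le> m + 3" "m \<le> 2 * s" using k s by (auto simp: m_def)
  ultimately show ?thesis using cop that by blast
qed

text \<open>The exponent and residue \<open>(n, r)\<close> are prolonged to \<open>(Suc N, s)\<close> so as to create the
  approximation \<open>(a, b)\<close> of order exactly \<open>N\<close>.\<close>

definition stage ::
  "int \<Rightarrow> real \<Rightarrow> int \<Rightarrow> nat \<Rightarrow> int \<Rightarrow> nat \<Rightarrow> int \<Rightarrow> int \<Rightarrow> int \<Rightarrow> bool" where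
  "stage q \<mu> K n r N s a b \<longleftrightarrow>
     n \<le> N \<and> q ^ n dvd s - r \<and> \<not> q dvd s \<and>
     coprime a b \<and> \<not> q dvd a \<and> \<not> q dvd b \<and> K \<le> \<bar>a\<bar> \<and> K \<le> \<bar>b\<bar> \<and>
     \<bar>a\<bar> \<le> 2 * \<bar>b\<bar> \<and> \<bar>b\<bar> \<le> 2 * \<bar>a\<bar> \<and> approx q N s a b \<and> \<not> approx q (Suc N) s a b \<and>
     real_of_int q ^ N \<le> real_of_int \<bar>a\<bar> powr \<mu> \<and>
     real_of_int \<bar>a\<bar> powr \<mu> \<le> real_of_int q ^ Suc N \<and>
     (\<forall>i\<in>{n..N}. avoiding q i s \<or> dominating q i s a b)"

text \<open>Shortest vectors are expelled up to level \<open>2 * S\<close>, which yields a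
  near-diagonal vector \<open>(a, b)\<close> at some level \<open>m\<close>. The digits from
  \<open>m\<close> on are then replaced so that its order is exactly \<open>N\<close>. Since \<mu> >
  2 and \<open>q ^ m\<close> is at most a constant times \<open>a ^ 2\<close>, a large
  \<open>a\<close> guarantees \<open>m \<le> N\<close>. Levels below \<open>m\<close> are avoiding,
  the others are dominated by \<open>(a, b)\<close>.\<close>

lemma stage_exists:
  assumes q: "prime q" and \<mu>: "\<mu> > 2" and n: "n \<ge> 1" and r: "\<not> q dvd r"
  obtains N s a b where "stage q \<mu> K n r N s a b"
proof -
  have q2: "q \<ge> 2" using q by (rule prime_ge_2_int)
  \<comment> \<open>Once \<open>L \<le> \<bar>a\<bar>\<close>, the ceiling ensures
    \<open>8 * q \<le> \<bar>a\<bar> powr (\<mu> - 2)\<close>, which absorbs the constant in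
    \<open>q ^ m \<le> 8 * q * a ^ 2\<close>.\<close>
  define L where "L = max (max K 1) \<lceil>real_of_int (8 * q) powr (1 / (\<mu> - 2))\<rceil>"
  \<comment> \<open>As \<open>S \<le> m + 3\<close>, this gives \<open>2 * n \<le> m\<close>, as
    balance requires, and \<open>8 * q * L ^ 2 \<le> 2 ^ m \<le> q ^ m\<close>, which forces both
    entries to be at least \<open>L\<close> in absolute value.\<close>
  define S where "S = 3 + 2 * n + nat (8 * q * L ^ 2)"
  obtain t where t: "q ^ n dvd t - r" "\<forall>i\<in>{n..<n + 2 * S}. avoiding q i t"
    using avoiding_extend[OF q] .
  have unit: "\<not> q dvd y" if "q ^ n dvd y - r" for y
  proof
    assume "q dvd y"
    moreover have "q dvd y - r"
      using that n by (meson dvd_power dvd_trans order_less_le_trans zero_less_one)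
    ultimately have "q dvd y - (y - r)" by (rule dvd_diff)
    with r show False by simp
  qed
  note qt = unit[OF t(1)]
  have av: "\<forall>i\<in>{n..<2 * S}. avoiding q i t" using t(2) by auto
  obtain m a b where m: "S \<le> m + 3" "m \<le> 2 * S" and ab: "approx q m t a b" "coprime a b"
    "\<bar>a\<bar> \<le> 2 * \<bar>b\<bar>" "\<bar>b\<bar> \<le> 2 * \<bar>a\<bar>" "ht a b ^ 2 \<le> q ^ (m + 6)"
    by (rule coprime_approx_near_diagonal[OF q qt n _ av]) (auto simp: S_def)
  have nm: "2 * n \<le> m" "nat (8 * q * L ^ 2) \<le> m" using m by (auto simp: S_def)
  have avm: "\<forall>i\<in>{n..<m}. avoiding q i t" using av m by auto
  note bal = avoiding_balanced[OF q avm nm(1)]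
  have ndvd: "\<not> q dvd a" "\<not> q dvd b"
    using coprime_approx_not_dvd[OF q qt _ ab(1,2)] nm n by auto
  then have nz: "a \<noteq> 0" "b \<noteq> 0" by auto
  have main: "q ^ m \<le> 8 * q * x ^ 2" if "ht a b \<le> 2 * \<bar>x\<bar>" for x
  proof -
    have "ht a b ^ 2 \<le> (2 * \<bar>x\<bar>) ^ 2" using that ht_nonneg by (intro power_mono)
    then have "2 * q * ht a b ^ 2 \<le> 2 * q * (4 * x ^ 2)"
      using q2 by (intro mult_left_mono) (auto simp: power_mult_distrib)
    moreover have "q ^ m \<le> 2 * q * ht a b ^ 2" using bal[OF ab(1)] nz by (simp add: ht_pos_iff)
    ultimately show ?thesis by linarith
  qed
  have L: "L \<le> \<bar>x\<bar>" if "ht a b \<le> 2 * \<bar>x\<bar>" for x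
  proof -
    have "8 * q * L ^ 2 \<le> int m" using nm(2) by linarith
    also have "\<dots> \<le> 2 ^ m" using of_nat_less_two_power[of m] by (metis less_imp_le)
    also have "\<dots> \<le> q ^ m" using q2 by (intro power_mono) auto
    also have "\<dots> \<le> 8 * q * x ^ 2" by (rule main[OF that])
    finally have "L ^ 2 \<le> x ^ 2" using q2 by simp
    then show ?thesis by (metis abs_ge_zero power2_abs power2_le_imp_le)
  qed
  have ha: "ht a b \<le> 2 * \<bar>a\<bar>" "ht a b \<le> 2 * \<bar>b\<bar>" using ab(3,4) by (auto simp: ht_def)
  define h where "h = real_of_int \<bar>a\<bar>"
  have h1: "h \<ge> 1" using nz by (simp add: h_def)
  have hL: "real_of_int (8 * q) powr (1 / (\<mu> - 2)) \<le> h"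
    using L[OF ha(1)] by (simp add: L_def h_def ceiling_le_iff)
  have "real_of_int (8 * q) = (real_of_int (8 * q) powr (1 / (\<mu> - 2))) powr (\<mu> - 2)"
    using \<mu> q2 by (simp add: powr_powr)
  also have "\<dots> \<le> h powr (\<mu> - 2)" using hL \<mu> by (intro powr_mono2) auto
  finally have h8: "real_of_int (8 * q) \<le> h powr (\<mu> - 2)" .
  have "real_of_int (q ^ m) \<le> real_of_int (8 * q * a ^ 2)"
    using main[OF ha(1)] by (simp only: of_int_le_iff)
  also have "\<dots> = real_of_int (8 * q) * h powr 2"
    using h1 by (simp add: h_def powr_numeral)
  also have "\<dots> \<le> h powr (\<mu> - 2) * h powr 2" using h8 by (intro mult_right_mono) auto
  also have "\<dots> = h powr \<mu>" by (simp flip: powr_add)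
  finally have qm: "real_of_int q ^ m \<le> h powr \<mu>" by simp
  \<comment> \<open>The level at which \<open>\<bar>a\<bar> powr \<mu>\<close> lies between
    \<open>q ^ N\<close> and \<open>q ^ Suc N\<close>.\<close>
  define N where "N = nat \<lfloor>log (real_of_int q) (h powr \<mu>)\<rfloor>"
  have hp: "h powr \<mu> > 0" using h1 by simp
  have mlog: "real m \<le> log (real_of_int q) (h powr \<mu>)"
    using qm q2 hp by (simp add: le_log_iff powr_realpow)
  then have mN: "m \<le> N" by (simp add: N_def le_nat_floor)
  have Nlog: "real N \<le> log (real_of_int q) (h powr \<mu>)" "log (real_of_int q) (h powr \<mu>) \<le> real (Suc N)"
    using mlog by (auto simp: N_def; linarith)+
  have N: "real_of_int q ^ N \<le> h powr \<mu>" "h powr \<mu> \<le> real_of_int q ^ Suc N"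
    using Nlog q2 hp powr_realpow[of "real_of_int q" "Suc N"]
    by (simp_all add: le_log_iff log_le_iff powr_realpow)
  obtain s where s: "q ^ m dvd s - t" "approx q N s a b" "\<not> approx q (Suc N) s a b"
    using approx_prescribed_order[OF q ndvd(2) ab(1) mN] .
  have "q ^ n dvd (s - t) + (t - r)"
    using s(1) t(1) nm(1) by (intro dvd_add dvd_trans[OF le_imp_power_dvd s(1)]) auto
  then have sr: "q ^ n dvd s - r" by simp
  have q7: "q ^ 7 = q ^ 6 * q" "q * q ^ 7 = (q ^ 4) ^ 2"
    by (simp_all flip: power_Suc power_Suc2 power_mult)
  have i_steps: "avoiding q i s \<or> dominating q i s a b" if i: "i \<in> {n..N}" for i
  proof (cases "i < m")
    case True
    then have "q ^ Suc i dvd s - t" using s(1) by (meson Suc_leI dvd_trans le_imp_power_dvd)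
    then show ?thesis using avoiding_cong avm i True by auto
  next
    case False
    \<comment> \<open>From level \<open>m\<close> on, every competitor lies in L_m, where balance
      bounds its height from below; this is compared with
      \<open>ht a b ^ 2 \<le> q ^ (m + 6)\<close>.\<close>
    have "ht a b \<le> q ^ 4 * ht c d" if cd: "approx q i s c d" "ht c d > 0" for c d
    proof -
      have "approx q m t c d"
        using approx_mono[OF cd(1), of m] False approx_cong[OF s(1)] by auto
      from bal[OF this cd(2)] have "q ^ 6 * q ^ m \<le> q ^ 6 * (2 * q * ht c d ^ 2)"
        using q2 by (intro mult_left_mono) auto
      also have "\<dots> = 2 * (q ^ 7 * ht c d ^ 2)" unfolding q7(1) by simp
      also have "\<dots> \<le> q * (q ^ 7 * ht c d ^ 2)" using q2 by (intro mult_right_mono) auto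
      also have "\<dots> = (q ^ 4 * ht c d) ^ 2"
        unfolding power_mult_distrib q7(2)[symmetric] by simp
      finally have "q ^ (m + 6) \<le> (q ^ 4 * ht c d) ^ 2"
        by (simp only: power_add mult.commute[of "q ^ m"])
      with ab(5) have "ht a b ^ 2 \<le> (q ^ 4 * ht c d) ^ 2" by linarith
      moreover have "0 \<le> q ^ 4 * ht c d" using q2 cd(2) by simp
      ultimately show ?thesis by (rule power2_le_imp_le)
    qed
    then show ?thesis
      using approx_mono[OF s(2), of i] i by (simp add: dominating_def)
  qed
  then have "stage q \<mu> K n r N s a b"
    unfolding stage_def
    using N s(2,3) sr unit[OF sr] ndvd ab(2-4) L[OF ha(1)] L[OF ha(2)] nm(1) mN i_steps
    unfolding h_def L_def by auto
  then show ?thesis by (rule that)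
qed

section \<open>The \<open>p\<close>-adic limit\<close>

text \<open>The next stage starts from \<open>Suc (N j)\<close>, so that the digit which ends the
  approximation \<open>(a j, b j)\<close> is kept. The bound \<open>int j + 2\<close> sends the
  entries to infinity, and \<open>\<bar>a j\<bar> ^ j\<close> will make the quotient of logarithms
  at least \<open>j\<close>.\<close>

lemma stage_sequence:
  assumes q: "prime q" and \<mu>: "\<mu> > 2"
  shows "\<exists>N r a b. N 0 = 0 \<and>
    (\<forall>j. stage q \<mu> (max (int j + 2) (\<bar>a j\<bar> ^ j)) (Suc (N j)) (r j)
       (N (Suc j)) (r (Suc j)) (a (Suc j)) (b (Suc j)))"
proof -
  \<comment> \<open>The clause for \<open>j = 0\<close> carries \<open>N 0 = 0\<close> out of the
    choice principle; that \<open>q\<close> does not divide \<open>r\<close> is what the next stage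
    needs.\<close>
  define P :: "nat \<Rightarrow> nat \<times> int \<times> int \<times> int \<Rightarrow> bool"
    where "P = (\<lambda>j (N, r, a, b). (j = 0 \<longrightarrow> N = 0) \<and> \<not> q dvd r)"
  define Q :: "nat \<Rightarrow> nat \<times> int \<times> int \<times> int \<Rightarrow> nat \<times> int \<times> int \<times> int \<Rightarrow> bool"
    where "Q = (\<lambda>j (N, r, a, b) (N', r', a', b').
      stage q \<mu> (max (int j + 2) (\<bar>a\<bar> ^ j)) (Suc N) r N' r' a' b')"
  have "\<exists>f. \<forall>j. P j (f j) \<and> Q j (f j) (f (Suc j))"
  proof (rule dependent_nat_choice)
    have "\<not> q dvd 1" using prime_gt_1_int[OF q] by simp
    then show "\<exists>x. P 0 x" by (intro exI[of _ "(0, 1, 1, 1)"]) (simp add: P_def)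
  next
    fix x j assume P: "P j x"
    obtain N r a b where x: "x = (N, r, a, b)" by (metis prod_cases4)
    have r: "\<not> q dvd r" using P by (simp add: P_def x)
    obtain N' r' a' b' where
      "stage q \<mu> (max (int j + 2) (\<bar>a\<bar> ^ j)) (Suc N) r N' r' a' b'"
      by (rule stage_exists[OF q \<mu> _ r, of "Suc N" "max (int j + 2) (\<bar>a\<bar> ^ j)"]) auto
    then have "P (Suc j) (N', r', a', b') \<and> Q j x (N', r', a', b')"
      by (simp add: P_def Q_def x stage_def)
    then show "\<exists>y. P (Suc j) y \<and> Q j x y" by blast
  qed
  then obtain f where f: "\<And>j. P j (f j)" "\<And>j. Q j (f j) (f (Suc j))" by blast
  show ?thesis
    using f(1)[of 0] f(2)
    by (intro exI[of _ "fst \<circ> f"] exI[of _ "fst \<circ> snd \<circ> f"]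
        exI[of _ "fst \<circ> snd \<circ> snd \<circ> f"] exI[of _ "snd \<circ> snd \<circ> snd \<circ> f"])
      (simp add: P_def Q_def case_prod_beta)
qed

text \<open>Induction on \<open>n\<close>. If \<open>(c, d)\<close> is \<open>q\<close> times a
  vector of L_n, that vector is still not parallel to any \<open>(a j, b j)\<close>, and the gain
  \<open>q ^ 2\<close> in the squared height exceeds the gain \<open>q\<close> in the index. At a
  dominating level the determinant bound is applied with \<open>(a j, b j)\<close>, whose height is
  at most \<open>q ^ 4 * ht c d\<close>.\<close>

lemma nonparallel_lower_bound:
  fixes a b :: "nat \<Rightarrow> int"
  assumes q: "prime q" and \<xi>: "\<And>i. q ^ i dvd \<xi> (Suc i) - \<xi> i"
    and step: "\<And>i. i \<ge> 1 \<Longrightarrow>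
      avoiding q i (\<xi> (Suc i)) \<or> (\<exists>j\<ge>1. dominating q i (\<xi> i) (a j) (b j))"
    and z: "\<forall>j\<ge>1. a j * d \<noteq> b j * c"
    and ap: "approx q n (\<xi> n) c d"
  shows "q ^ n \<le> 2 * q ^ 5 * ht c d ^ 2"
  using z ap
proof (induction n arbitrary: c d)
  have q2: "q \<ge> 2" using q by (rule prime_ge_2_int)
  have q5: "q ^ 5 = q * q ^ 4" by (simp add: power_numeral_reduce)
  have ht1: "ht c d \<ge> 1" if "\<forall>j\<ge>1. a j * d \<noteq> b j * c" for c d
    using that[rule_format, of 1] ht_pos_iff[of c d] by auto
  {
    case 0
    have "ht c d ^ 2 \<ge> 1" "q ^ 5 \<ge> 1" using ht1[OF 0(1)] q2 by auto
    then have "1 * 1 \<le> q ^ 5 * ht c d ^ 2" using q2 by (intro mult_mono) auto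
    then show ?case by simp
  next
    case (Suc n)
    have Z: "ht c d \<ge> 1" using ht1[OF Suc.prems(1)] .
    have ap: "approx q n (\<xi> (Suc n)) c d" by (rule approx_mono[OF Suc.prems(2)]) simp
    \<comment> \<open>All cases but the inductive one bound \<open>q ^ n\<close> instead of
      \<open>q ^ Suc n\<close>; this lag turns \<open>q ^ 4\<close> into
      \<open>q ^ 5\<close>.\<close>
    have claim: ?case if "q ^ n \<le> 2 * q ^ 4 * ht c d ^ 2"
      using mult_left_mono[OF that, of q] q2 by (simp add: q5 mult_ac)
    have q4: "q ^ 4 \<ge> 1" using q2 by simp
    \<comment> \<open>The hypothesis \<open>step\<close> starts at level 1; at level 0 it suffices
      that heights are at least 1.\<close>
    consider "n = 0" | "avoiding q n (\<xi> (Suc n))"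
      | j where "j \<ge> 1" "dominating q n (\<xi> n) (a j) (b j)"
      using step[of n] by fastforce
    then show ?case
    proof cases
      case 1
      have "1 * 1 \<le> q ^ 4 * ht c d ^ 2" using q2 q4 Z by (intro mult_mono) auto
      with 1 show ?thesis by (intro claim) simp
    next
      case 2
      from avoiding_dichotomy[OF q 2 Suc.prems(2)]
      consider "q ^ n \<le> 2 * ht c d ^ 2"
        | c' d' where "c = q * c'" "d = q * d'" "approx q n (\<xi> (Suc n)) c' d'" by blast
      then show ?thesis
      proof cases
        case 1
        have "1 * ht c d ^ 2 \<le> q ^ 4 * ht c d ^ 2" using q4 by (intro mult_right_mono) auto
        with 1 show ?thesis by (intro claim) simp
      next
        case 2
        have "approx q n (\<xi> n) c' d'" using 2(3) approx_cong[OF \<xi>] by blast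
        moreover have "\<forall>j\<ge>1. a j * d' \<noteq> b j * c'" using Suc.prems(1) 2 by (auto simp: algebra_simps)
        ultimately have "q ^ n \<le> 2 * q ^ 5 * ht c' d' ^ 2" by (intro Suc.IH)
        then have "q ^ 2 * q ^ n \<le> q ^ 2 * (2 * q ^ 5 * ht c' d' ^ 2)"
          using q2 by (intro mult_left_mono) auto
        moreover have "q * q ^ n \<le> q ^ 2 * q ^ n"
          using q2 by (intro mult_right_mono) (auto simp: power2_eq_square)
        moreover have "ht c d = q * ht c' d'" using q2 2 by (simp add: ht_mult)
        ultimately show ?thesis by (simp add: power_mult_distrib mult_ac)
      qed
    next
      case 3
      have ap': "approx q n (\<xi> n) c d" using ap approx_cong[OF \<xi>] by blast
      have "q ^ n \<le> 2 * (ht (a j) (b j) * ht c d)"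
        using approx_det_le[OF _ _ ap', of "a j" "b j"] 3 Suc.prems(1) q2 by (auto simp: dominating_def)
      also have "\<dots> \<le> 2 * ((q ^ 4 * ht c d) * ht c d)"
        using 3(2) ap' Z by (intro mult_left_mono mult_right_mono) (auto simp: dominating_def)
      finally show ?thesis by (intro claim) (simp add: power2_eq_square mult_ac)
    qed
  }
qed

section \<open>Linear forms and their p-adic absolute values\<close>

abbreviation linear_form :: "nat \<Rightarrow> (nat \<Rightarrow> int) \<Rightarrow> int \<Rightarrow> int \<Rightarrow> nat \<Rightarrow> int" where
  "linear_form p \<xi> a b \<equiv>
    padic_of_int p b \<otimes>\<^bsub>padic_int p\<^esub> \<xi> \<ominus>\<^bsub>padic_int p\<^esub> padic_of_int p a"

lemma linear_form_eq_0_iff: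
  assumes "p > 0" "\<xi> \<in> carrier (padic_int p)"
  shows "linear_form p \<xi> a b n = 0 \<longleftrightarrow> approx (int p) n (\<xi> n) a b"
proof -
  note of_int = padic_of_int_closed[OF assms(1)]
  show ?thesis
    unfolding padic_minus_nth[OF assms(1) padic_mult_closed[OF assms(1) of_int assms(2)] of_int]
    by (simp add: padic_int_simps padic_of_int_def approx_def mod_simps mod_eq_0_iff_dvd)
qed

lemma padic_int_cong:
  assumes "\<xi> \<in> carrier (padic_int p)"
  shows "int p ^ n dvd \<xi> (Suc n) - \<xi> n"
  using padic_int_memD[OF assms, of n] by (metis mod_eq_dvd_iff)

lemma approx_padic_mono:
  assumes \<xi>: "\<xi> \<in> carrier (padic_int p)" and "approx (int p) n (\<xi> n) a b" "m \<le> n"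
  shows "approx (int p) m (\<xi> m) a b"
  using assms(3,2)
proof (induction m rule: inc_induct)
  case (step m)
  then have "approx (int p) m (\<xi> (Suc m)) a b" using approx_mono by (metis lessI less_imp_le)
  then show ?case using approx_cong[OF padic_int_cong[OF \<xi>]] by blast
qed

lemma padic_abs_linear_form:
  assumes p: "p > 0" and \<xi>: "\<xi> \<in> carrier (padic_int p)"
    and N: "approx (int p) N (\<xi> N) a b" "\<not> approx (int p) (Suc N) (\<xi> (Suc N)) a b"
  shows "padic_abs p (linear_form p \<xi> a b) = (1 / real p) ^ N"
proof -
  note eq0 = linear_form_eq_0_iff[OF p \<xi>]
  have "linear_form p \<xi> a b \<noteq> \<zero>\<^bsub>padic_int p\<^esub>"
    using eq0[of b a "Suc N"] N(2) by (auto simp: padic_int_simps fun_eq_iff)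
  moreover have "padic_val (linear_form p \<xi> a b) = N"
    unfolding padic_val_def
  proof (rule Least_equality)
    fix n assume "linear_form p \<xi> a b (Suc n) \<noteq> 0"
    then show "N \<le> n"
      using approx_padic_mono[OF \<xi> N(1), of "Suc n"] by (force simp: eq0)
  qed (use N(2) in \<open>simp add: eq0\<close>)
  ultimately show ?thesis by (simp add: padic_abs_def)
qed

text \<open>Powers of \<open>p\<close> are unbounded, so the congruence fails at some level; at the
  last level \<open>N\<close> before that, the absolute value is the inverse of
  \<open>p ^ N\<close>, which is at most \<open>C\<close>.\<close>

lemma padic_abs_linear_form_ge:
  assumes p: "p > 1" and \<xi>: "\<xi> \<in> carrier (padic_int p)"
    and bound: "\<And>n. approx (int p) n (\<xi> n) a b \<Longrightarrow> int p ^ n \<le> C"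
  shows "1 \<le> real_of_int C * padic_abs p (linear_form p \<xi> a b)"
proof -
  have "\<exists>n. \<not> approx (int p) n (\<xi> n) a b"
  proof (rule ccontr)
    assume "\<not> ?thesis"
    then have "int p ^ nat C \<le> C" using bound by blast
    moreover have "int (nat C) < int p ^ nat C"
      using p by (metis of_nat_less_iff of_nat_power power_gt_expt One_nat_def)
    ultimately show False by linarith
  qed
  then obtain n where n: "\<not> approx (int p) n (\<xi> n) a b"
    "\<And>m. m < n \<Longrightarrow> approx (int p) m (\<xi> m) a b"
    using exists_least_iff[of "\<lambda>n. \<not> approx (int p) n (\<xi> n) a b"] by auto
  \<comment> \<open>The first failing level is positive, because a congruence modulo
    \<open>p ^ 0 = 1\<close> always holds.\<close>
  then obtain N where N: "n = Suc N" by (cases n) (auto simp: approx_def)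
  have ap: "approx (int p) N (\<xi> N) a b" using n(2) N by simp
  have "real_of_int (int p ^ N) \<le> real_of_int C" using bound[OF ap] by (simp only: of_int_le_iff)
  then have "real p ^ N * (1 / real p) ^ N \<le> real_of_int C * (1 / real p) ^ N"
    by (intro mult_right_mono) auto
  then show ?thesis
    using padic_abs_linear_form[OF _ \<xi> ap] n(1) N p by (simp add: power_divide)
qed

lemma powr_neg_le_of_le_double:
  fixes x y \<mu> :: real
  assumes "x > 0" "x \<le> 2 * y" "\<mu> \<ge> 0"
  shows "y powr (- \<mu>) \<le> 2 powr \<mu> * x powr (- \<mu>)"
proof -
  have "y powr (- \<mu>) \<le> (x / 2) powr (- \<mu>)" using assms by (intro powr_mono2') auto
  also have "\<dots> = 2 powr \<mu> * x powr (- \<mu>)"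
    using assms by (simp add: powr_divide powr_minus divide_simps)
  finally show ?thesis .
qed

text \<open>A vanishing determinant gives relations with coefficients \<open>(b, - d)\<close> and
  \<open>(a, - c)\<close>. Independence then makes \<open>a = b = 0\<close>, and the coefficients
  \<open>(0, 1)\<close> give a nontrivial relation.\<close>

lemma lin_indep_pair_det:
  assumes "lin_indep_pair (c, d) (a, b)"
  shows "a * d \<noteq> b * c"
proof
  assume eq: "a * d = b * c"
  have 1: "\<alpha> * c + \<beta> * a = 0 \<Longrightarrow> \<alpha> * d + \<beta> * b = 0 \<Longrightarrow> \<alpha> = 0 \<and> \<beta> = 0" for \<alpha> \<beta>
    using assms unfolding lin_indep_pair_def fst_conv snd_conv by blast
  have "b * c + (- d) * a = 0" "b * d + (- d) * b = 0" "a * c + (- c) * a = 0" "a * d + (- c) * b = 0"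
    using eq mult.commute[of d a] mult.commute[of d b] mult.commute[of c a] mult.commute[of c b]
    by (simp_all only: minus_mult_left[symmetric])
  with 1[of b "- d"] 1[of a "- c"] have "a = 0" "b = 0" by blast+
  with 1[of 0 1] show False by simp
qed

theorem theorem6p1:
  fixes p :: nat and \<mu> \<epsilon> :: real
  assumes "prime p" and "\<mu> > 2" and "\<epsilon> > 0"
  shows "\<exists>\<xi> \<in> carrier (padic_int p). \<exists>x0 x1 :: nat \<Rightarrow> int.
    (\<forall>j\<ge>1. coprime (x0 j) (x1 j) \<and> \<not> int p dvd x0 j \<and> \<not> int p dvd x1 j) \<and>
    filterlim (\<lambda>j. \<bar>x0 j\<bar>) at_top sequentially \<and>
    filterlim (\<lambda>j. \<bar>x1 j\<bar>) at_top sequentially \<and>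
    same_order_on {1..} (\<lambda>j. real_of_int \<bar>x0 j\<bar>) (\<lambda>j. real_of_int \<bar>x1 j\<bar>) \<and>
    same_order_on {1..}
      (\<lambda>j. padic_abs p (padic_of_int p (x1 j) \<otimes>\<^bsub>padic_int p\<^esub> \<xi> \<ominus>\<^bsub>padic_int p\<^esub> padic_of_int p (x0 j)))
      (\<lambda>j. real_of_int \<bar>x0 j\<bar> powr (- \<mu>)) \<and>
    same_order_on {1..}
      (\<lambda>j. real_of_int \<bar>x0 j\<bar> powr (- \<mu>)) (\<lambda>j. real_of_int \<bar>x1 j\<bar> powr (- \<mu>)) \<and>
    filterlim (\<lambda>j. ln (real_of_int \<bar>x0 (Suc j)\<bar>) / ln (real_of_int \<bar>x0 j\<bar>)) at_top sequentially \<and>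
    ll_on {(z0, z1). \<forall>j\<ge>1. lin_indep_pair (z0, z1) (x0 j, x1 j)}
      (\<lambda>(z0, z1). real_of_int (max \<bar>z0\<bar> \<bar>z1\<bar>) powr (- 2 - \<epsilon>))
      (\<lambda>(z0, z1). padic_abs p (padic_of_int p z1 \<otimes>\<^bsub>padic_int p\<^esub> \<xi> \<ominus>\<^bsub>padic_int p\<^esub> padic_of_int p z0))"
proof -
  define q where "q = int p"
  have q: "prime q" using assms(1) by (simp add: q_def)
  have p1: "p > 1" "p > 0" using prime_gt_1_nat[OF assms(1)] by auto
  obtain N r a b where N0: "N 0 = 0" and
    stages: "\<forall>j. stage q \<mu> (max (int j + 2) (\<bar>a j\<bar> ^ j)) (Suc (N j)) (r j)
       (N (Suc j)) (r (Suc j)) (a (Suc j)) (b (Suc j))"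
    using stage_sequence[OF q assms(2)] by blast
  note stage = spec[OF stages]

  \<comment> \<open>The limit of the residues\<close>
  have N_Suc: "N j < N (Suc j)" for j using stage[of j] by (simp add: stage_def Suc_le_eq)
  then have N_mono: "strict_mono N" by (simp add: strict_mono_Suc_iff)
  have N_ge: "j \<le> N j" for j using N_mono by (rule strict_mono_imp_increasing)
  have r_cong: "q ^ Suc (N j) dvd r k - r j" if "j \<le> k" for j k
    using that
  proof (induction k rule: dec_induct)
    case (step k)
    have "Suc (N j) \<le> Suc (N k)" using N_mono step.hyps by (simp add: strict_mono_less_eq)
    moreover have "q ^ Suc (N k) dvd r (Suc k) - r k" using stage[of k] by (simp only: stage_def)
    ultimately have "q ^ Suc (N j) dvd r (Suc k) - r k" by (meson dvd_trans le_imp_power_dvd)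
    from dvd_add[OF this step.IH] show ?case by simp
  qed simp
  have r_cong': "q ^ i dvd r k - r j" if "i \<le> Suc (N j)" "i \<le> Suc (N k)" for i j k
  proof (cases "j \<le> k")
    case True
    then show ?thesis using r_cong[of j k] that by (meson dvd_trans le_imp_power_dvd)
  next
    case False
    then have "q ^ i dvd r j - r k" using r_cong[of k j] that by (meson dvd_trans le_imp_power_dvd nat_le_linear)
    then show ?thesis by (simp add: dvd_diff_commute)
  qed
  \<comment> \<open>All later residues agree with \<open>r n\<close> modulo
    \<open>q ^ Suc (N n)\<close>, and \<open>n \<le> N n\<close>, so \<open>r n mod q ^ n\<close> is
    final.\<close>
  define \<xi> where "\<xi> = (\<lambda>n. r n mod q ^ n)"
  have \<xi>r: "q ^ i dvd \<xi> i - r j" if "i \<le> Suc (N j)" for i j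
  proof -
    have "q ^ i dvd (\<xi> i - r i) + (r i - r j)"
      using that N_ge[of i] r_cong'[of i j i]
      by (intro dvd_add) (auto simp: \<xi>_def mod_eq_dvd_iff[symmetric])
    then show ?thesis by simp
  qed
  have \<xi>: "\<xi> \<in> carrier (padic_int p)"
  proof (rule padic_int_memI[where f = r])
    show "r (Suc n) mod int p ^ n = r n mod int p ^ n" for n
      using r_cong'[of n n "Suc n"] N_ge[of n] N_ge[of "Suc n"] by (simp add: mod_eq_dvd_iff q_def)
  qed (use p1 in \<open>auto simp: \<xi>_def q_def\<close>)
  have steps: "avoiding q i (\<xi> (Suc i)) \<or> (\<exists>j\<ge>1. dominating q i (\<xi> i) (a j) (b j))"
    if i: "i \<ge> 1" for i
  proof -
    \<comment> \<open>The stage containing level \<open>i\<close>: \<open>N j < i \<le> N k\<close>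
      with \<open>k = Suc j\<close>. Since \<xi> agrees with \<open>r k\<close> up to level
      \<open>Suc (N k)\<close>, both alternatives carry over.\<close>
    define k where "k = (LEAST k. i \<le> N k)"
    have k: "i \<le> N k" unfolding k_def using N_ge[of i] by (rule LeastI)
    then have "k \<noteq> 0" using N0 i by (intro notI) simp
    then obtain j where j: "k = Suc j" by (cases k) auto
    have "\<not> i \<le> N j" unfolding k_def using not_less_Least[of j "\<lambda>k. i \<le> N k"] j k_def by simp
    then have "i \<in> {Suc (N j)..N k}" using k by auto
    then have "avoiding q i (r k) \<or> dominating q i (r k) (a k) (b k)"
      using stage[of j] unfolding stage_def j by blast
    then show ?thesis
      using avoiding_cong[OF \<xi>r[of "Suc i" k]] dominating_cong[OF \<xi>r[of i k]] k j by auto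
  qed

  \<comment> \<open>Size and order of the approximations\<close>
  have x: "coprime (a j) (b j)" "\<not> q dvd a j" "\<not> q dvd b j" "int j + 1 \<le> \<bar>a j\<bar>" "int j + 1 \<le> \<bar>b j\<bar>"
    "\<bar>a j\<bar> \<le> 2 * \<bar>b j\<bar>" "\<bar>b j\<bar> \<le> 2 * \<bar>a j\<bar>"
    "approx q (N j) (\<xi> (N j)) (a j) (b j)" "\<not> approx q (Suc (N j)) (\<xi> (Suc (N j))) (a j) (b j)"
    "real_of_int q ^ N j \<le> real_of_int \<bar>a j\<bar> powr \<mu>"
    "real_of_int \<bar>a j\<bar> powr \<mu> \<le> real_of_int q ^ Suc (N j)"
    if j1: "j \<ge> 1" for j
  proof -
    \<comment> \<open>The index shift turns the lower bound \<open>int i + 2\<close> into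
      \<open>int j + 1\<close>, so that entries exceed 1 in absolute value and their logarithms are
      positive.\<close>
    obtain i where i: "j = Suc i" using j1 by (cases j) auto
    show "coprime (a j) (b j)" "\<not> q dvd a j" "\<not> q dvd b j" "int j + 1 \<le> \<bar>a j\<bar>" "int j + 1 \<le> \<bar>b j\<bar>"
      "\<bar>a j\<bar> \<le> 2 * \<bar>b j\<bar>" "\<bar>b j\<bar> \<le> 2 * \<bar>a j\<bar>"
      "real_of_int q ^ N j \<le> real_of_int \<bar>a j\<bar> powr \<mu>"
      "real_of_int \<bar>a j\<bar> powr \<mu> \<le> real_of_int q ^ Suc (N j)"
      using stage[of i] by (simp_all add: stage_def i)
    show "approx q (N j) (\<xi> (N j)) (a j) (b j)" "\<not> approx q (Suc (N j)) (\<xi> (Suc (N j))) (a j) (b j)"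
      using stage[of i] approx_cong[OF \<xi>r[of "N j" j]] approx_cong[OF \<xi>r[of "Suc (N j)" j]]
      by (simp_all add: stage_def i)
  qed
  have x_pos: "real_of_int \<bar>a j\<bar> > 1" "real_of_int \<bar>b j\<bar> > 1" if "j \<ge> 1" for j
    using x(4,5)[OF that] that by linarith+
  have grow: "real_of_int \<bar>a j\<bar> ^ j \<le> real_of_int \<bar>a (Suc j)\<bar>" for j
  proof -
    have "\<bar>a j\<bar> ^ j \<le> \<bar>a (Suc j)\<bar>" using stage[of j] by (simp add: stage_def)
    then have "real_of_int (\<bar>a j\<bar> ^ j) \<le> real_of_int \<bar>a (Suc j)\<bar>" by (simp only: of_int_le_iff)
    then show ?thesis by simp
  qed
  have at_top: "filterlim f at_top sequentially" if "\<And>j. j \<ge> 1 \<Longrightarrow> int j + 1 \<le> f j" for f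
    unfolding filterlim_at_top
  proof
    fix Z :: int
    have "Z \<le> f j" if "j \<ge> max 1 (nat Z)" for j using \<open>j \<ge> 1 \<Longrightarrow> int j + 1 \<le> f j\<close> that by force
    then show "\<forall>\<^sub>F j in sequentially. Z \<le> f j" by (rule eventually_sequentiallyI)
  qed
  have abs_x: "padic_abs p (linear_form p \<xi> (a j) (b j)) = 1 / real_of_int q ^ N j" if "j \<ge> 1" for j
    using padic_abs_linear_form[OF p1(2) \<xi>, of "N j"] x(8,9)[OF that]
    by (simp add: q_def power_divide)
  have order_x: "same_order_on {1..} (\<lambda>j. padic_abs p (linear_form p \<xi> (a j) (b j)))
      (\<lambda>j. real_of_int \<bar>a j\<bar> powr (- \<mu>))"
    unfolding same_order_on_def
  proof
    have h: "real_of_int \<bar>a j\<bar> powr \<mu> > 0" "real_of_int q ^ N j > 0" if "j \<in> {1..}" for j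
      using x_pos[of j] that p1 by (simp_all add: q_def)
    \<comment> \<open>The constants \<open>p\<close> here and 1 below are the two sides of
      \<open>q ^ N j \<le> \<bar>a j\<bar> powr \<mu> \<le> q ^ Suc (N j)\<close>.\<close>
    have "padic_abs p (linear_form p \<xi> (a j) (b j)) \<le> real p * real_of_int \<bar>a j\<bar> powr (- \<mu>)"
      if "j \<in> {1..}" for j
      using x(11)[of j] h[OF that] that by (simp add: abs_x powr_minus field_simps q_def)
    then show "ll_on {1..} (\<lambda>j. padic_abs p (linear_form p \<xi> (a j) (b j)))
        (\<lambda>j. real_of_int \<bar>a j\<bar> powr (- \<mu>))"
      using p1 unfolding ll_on_def by (intro exI[of _ "real p"]) simp
    have "real_of_int \<bar>a j\<bar> powr (- \<mu>) \<le> 1 * padic_abs p (linear_form p \<xi> (a j) (b j))"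
      if "j \<in> {1..}" for j
      using x(10)[of j] h[OF that] that by (simp add: abs_x powr_minus field_simps)
    then show "ll_on {1..} (\<lambda>j. real_of_int \<bar>a j\<bar> powr (- \<mu>))
        (\<lambda>j. padic_abs p (linear_form p \<xi> (a j) (b j)))"
      unfolding ll_on_def by (intro exI[of _ 1]) simp
  qed
  have order_powr: "same_order_on {1..} (\<lambda>j. real_of_int \<bar>a j\<bar> powr (- \<mu>)) (\<lambda>j. real_of_int \<bar>b j\<bar> powr (- \<mu>))"
    unfolding same_order_on_def ll_on_def
  proof (intro conjI exI[of _ "2 powr \<mu>"] ballI)
    fix j :: nat assume "j \<in> {1..}"
    then have j: "j \<ge> 1" by simp
    show "real_of_int \<bar>a j\<bar> powr (- \<mu>) \<le> 2 powr \<mu> * real_of_int \<bar>b j\<bar> powr (- \<mu>)"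
      "real_of_int \<bar>b j\<bar> powr (- \<mu>) \<le> 2 powr \<mu> * real_of_int \<bar>a j\<bar> powr (- \<mu>)"
      using x_pos[OF j] x(6,7)[OF j] assms(2) by (intro powr_neg_le_of_le_double; linarith)+
  qed auto
  have order_ab: "same_order_on {1..} (\<lambda>j. real_of_int \<bar>a j\<bar>) (\<lambda>j. real_of_int \<bar>b j\<bar>)"
    unfolding same_order_on_def ll_on_def using x(6,7)
    by (intro conjI exI[of _ "2 :: real"]) force+
  have log_ratio: "filterlim (\<lambda>j. ln (real_of_int \<bar>a (Suc j)\<bar>) / ln (real_of_int \<bar>a j\<bar>)) at_top sequentially"
  proof (rule filterlim_at_top_mono[OF filterlim_real_sequentially])
    have "real j \<le> ln (real_of_int \<bar>a (Suc j)\<bar>) / ln (real_of_int \<bar>a j\<bar>)" if j: "j \<ge> 1" for j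
    proof -
      have "real j * ln (real_of_int \<bar>a j\<bar>) = ln (real_of_int \<bar>a j\<bar> ^ j)"
        using x_pos[OF j] by (simp add: ln_realpow)
      also have "\<dots> \<le> ln (real_of_int \<bar>a (Suc j)\<bar>)"
        using x_pos[OF j] x_pos[of "Suc j"] grow[of j] by simp
      finally show ?thesis using x_pos[OF j] by (simp add: pos_le_divide_eq)
    qed
    then show "\<forall>\<^sub>F j in sequentially. real j \<le> ln (real_of_int \<bar>a (Suc j)\<bar>) / ln (real_of_int \<bar>a j\<bar>)"
      by (rule eventually_sequentiallyI)
  qed

  \<comment> \<open>Pairs independent of all the approximations\<close>
  have others: "ll_on {(z0, z1). \<forall>j\<ge>1. lin_indep_pair (z0, z1) (a j, b j)}
      (\<lambda>(z0, z1). real_of_int (max \<bar>z0\<bar> \<bar>z1\<bar>) powr (- 2 - \<epsilon>))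
      (\<lambda>(z0, z1). padic_abs p (linear_form p \<xi> z0 z1))"
    unfolding ll_on_def
  proof (intro exI[of _ "real_of_int (2 * q ^ 5)"] conjI ballI)
    fix z assume z: "z \<in> {(z0, z1). \<forall>j\<ge>1. lin_indep_pair (z0, z1) (a j, b j)}"
    obtain c d where cd: "z = (c, d)" by fastforce
    with z have indep: "\<forall>j\<ge>1. a j * d \<noteq> b j * c" using lin_indep_pair_det by auto
    \<comment> \<open>Independence from the pair of index 1 excludes \<open>(0, 0)\<close>.\<close>
    then have "ht c d > 0" using ht_pos_iff[of c d] indep[rule_format, of 1] by auto
    define h where "h = real_of_int (ht c d)"
    have h: "h \<ge> 1" using \<open>ht c d > 0\<close> by (simp add: h_def)
    have "int p ^ n \<le> 2 * q ^ 5 * ht c d ^ 2" if "approx (int p) n (\<xi> n) c d" for n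
      using nonparallel_lower_bound[OF q padic_int_cong[OF \<xi>, folded q_def] steps indep] that
      by (simp add: q_def)
    from padic_abs_linear_form_ge[OF p1(1) \<xi> this]
    have *: "1 \<le> real_of_int (2 * q ^ 5) * padic_abs p (linear_form p \<xi> c d) * h ^ 2"
      by (simp add: h_def mult_ac)
    have "h powr (- 2 - \<epsilon>) \<le> h powr (- 2)" using h assms(3) by (intro powr_mono) auto
    also have "\<dots> = 1 / h ^ 2" using h by (simp add: powr_minus powr_numeral field_simps)
    also have "\<dots> \<le> real_of_int (2 * q ^ 5) * padic_abs p (linear_form p \<xi> c d)"
      using * h by (simp add: divide_le_eq)
    finally show "(case z of (z0, z1) \<Rightarrow> real_of_int (max \<bar>z0\<bar> \<bar>z1\<bar>) powr (- 2 - \<epsilon>))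
        \<le> real_of_int (2 * q ^ 5) * (case z of (z0, z1) \<Rightarrow> padic_abs p (linear_form p \<xi> z0 z1))"
      by (simp add: cd h_def ht_def)
  qed (use p1 in \<open>simp add: q_def\<close>)
  show ?thesis
  proof (rule bexI[OF _ \<xi>], rule exI[of _ a], rule exI[of _ b], intro conjI)
    show "\<forall>j\<ge>1. coprime (a j) (b j) \<and> \<not> int p dvd a j \<and> \<not> int p dvd b j"
      using x(1-3) by (simp add: q_def)
    show "filterlim (\<lambda>j. \<bar>a j\<bar>) at_top sequentially" using x(4) by (rule at_top)
    show "filterlim (\<lambda>j. \<bar>b j\<bar>) at_top sequentially" using x(5) by (rule at_top)
  qed (fact order_ab order_x order_powr log_ratio others)+
qed

end
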